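(* There exists a matching market with resource-regional caps in which no matching is both direct-envy stable and resource-efficient.
   Context: A matching market with resource-regional caps consists of: finite sets $\mathcal{S}$ (students), $\mathcal{C}$ (colleges), $\mathcal{R}$ (non-empty resources), and an additional empty resource $r_0$, with $\mathcal{R}_0=\mathcal{R}\cup\{r_0\}$; a quota $q_c>0$ for each $c\in\mathcal{C}$; for each $r\in\mathcal{R}$ a non-empty region $C_r\subseteq\mathcal{C}$ (regions may overlap) and a cap $q_r>0$; by convention $C_{r_0}=\mathcal{C}$ and $q_{r_0}=|\mathcal{S}|$; for each college $c$ a strict ranking $\succ_c$ of $\mathcal{S}$; for each student $s$ a strict ranking $\succ_s$ of $(\mathcal{C}\times\mathcal{R}_0)\cup\{\emptyset\}$. A pair $(c,r)$ is acceptable for $s$ if $(c,r)\succ_s\emptyset$. It is assumed that whenever $r\in\mathcal{R}$ and $(c,r)$ is acceptable for $s$, $(c,r)\succ_s(c,r_0)$. The set of contracts is $\mathcal{X}=\mathcal{S}\times\mathcal{C}\times\mathcal{R}_0$. A matching $\mu$ is a subset of $\mathcal{X}$ in which each student appears in at most one contract; $\mu_s$ denotes the contract of $s$ in $\mu$ (also identified with its college-resource pair), with $\mu_s=\emptyset$ if $s$ is unmatched (and then $\mu\setminus\{\mu_s\}=\mu$). $\mu$ is feasible if each college $c$ is in at most $q_c$ contracts of $\mu$, and for each $r\in\mathcal{R}$ at most $q_r$ contracts of $\mu$ contain $r$, all of them with colleges in $C_r$. $\mu$ is individually rational if $(c,r)\succ_s\emptyset$ for each $(s,c,r)\in\mu$.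 Let $\mu$ be feasible and individually rational. - $(s,c,r)\in\mathcal{X}\setminus\mu$ envy-blocks $\mu$ through $(s',c,r')\in\mu$ if $(c,r)\succ_s\mu_s$, $s\succ_c s'$, and $(\mu\setminus\{\mu_s,(s',c,r')\})\cup\{(s,c,r)\}$ is feasible. It direct-envy-blocks $\mu$ if it envy-blocks $\mu$ through some $(s',c,r')\in\mu$ with $r\in\{r',r_0\}$. - $(s,c,r)\in\mathcal{X}\setminus\mu$ waste-blocks $\mu$ if $(c,r)\succ_s\mu_s$ and $(\mu\setminus\{\mu_s\})\cup\{(s,c,r)\}$ is feasible. A waste-blocking contract $(s,c,r)$ is resource-blocking if $s$ is already admitted to $c$ under $\mu$ (with another resource). $\mu$ is resource-efficient if it has no resource-blocking contracts. - A waste-blocking contract $(s,c,r)$ is dominated if there is a contract $(s',c,r')\in\mathcal{X}\setminus\mu$ (same college $c$) that is neither waste-blocking nor direct-envy-blocking under $\mu$, but is direct-envy-blocking under $(\mu\setminus\{\mu_s\})\cup\{(s,c,r)\}$. A feasible individually rational matching is direct-envy stable if it has no direct-envy-blocking contracts and every waste-blocking contract is dominated. *)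

theory Defs
  imports Main
begin

text \<open>
  The resource set with the empty resource added is encoded by the option type:
  the empty resource is \<^term>\<open>None\<close>, a non-empty resource \<open>r\<close> is \<open>Some r\<close>.
  Similarly, an outcome of a student is \<^term>\<open>None\<close> (unmatched) or \<open>Some (c, r)\<close>.
  Rankings are strict: a pair \<open>(x, y)\<close> in a ranking means that \<open>x\<close> is preferred to \<open>y\<close>.
\<close>

type_synonym ('c, 'r) outcome = "('c \<times> 'r option) option"
type_synonym ('s, 'c, 'r) contract = "'s \<times> 'c \<times> 'r option"

record ('s, 'c, 'r) market =
  students :: "'s set"
  colleges :: "'c set"
  resources :: "'r set"
  quota :: "'c \<Rightarrow> nat"
  region :: "'r option \<Rightarrow> 'c set"
  cap :: "'r option \<Rightarrow> nat"
  college_pref :: "'c \<Rightarrow> 's rel"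
  student_pref :: "'s \<Rightarrow> ('c, 'r) outcome rel"

definition resources0 :: "('s, 'c, 'r) market \<Rightarrow> 'r option set" where
  "resources0 M = insert None (Some ` resources M)"

definition outcomes :: "('s, 'c, 'r) market \<Rightarrow> ('c, 'r) outcome set" where
  "outcomes M = insert None (Some ` (colleges M \<times> resources0 M))"

definition strict_ranking :: "'a set \<Rightarrow> 'a rel \<Rightarrow> bool" where
  "strict_ranking A P \<longleftrightarrow> P \<subseteq> A \<times> A \<and> strict_linear_order_on A P"

definition acceptable :: "('s, 'c, 'r) market \<Rightarrow> 's \<Rightarrow> 'c \<times> 'r option \<Rightarrow> bool" where
  "acceptable M s p \<longleftrightarrow> (Some p, None) \<in> student_pref M s"

definition matching_market :: "('s, 'c, 'r) market \<Rightarrow> bool" where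
  "matching_market M \<longleftrightarrow>
     finite (students M) \<and> finite (colleges M) \<and> finite (resources M) \<and>
     (\<forall>c\<in>colleges M. quota M c > 0) \<and>
     (\<forall>r\<in>resources M. region M (Some r) \<noteq> {} \<and> region M (Some r) \<subseteq> colleges M \<and>
        cap M (Some r) > 0) \<and>
     region M None = colleges M \<and> cap M None = card (students M) \<and>
     (\<forall>c\<in>colleges M. strict_ranking (students M) (college_pref M c)) \<and>
     (\<forall>s\<in>students M. strict_ranking (outcomes M) (student_pref M s)) \<and>
     (\<forall>s\<in>students M. \<forall>c\<in>colleges M. \<forall>r\<in>resources M.
        acceptable M s (c, Some r) \<longrightarrow>
          (Some (c, Some r), Some (c, None)) \<in> student_pref M s)"

definition contracts :: "('s, 'c, 'r) market \<Rightarrow> ('s, 'c, 'r) contract set" where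
  "contracts M = students M \<times> colleges M \<times> resources0 M"

definition matching :: "('s, 'c, 'r) market \<Rightarrow> ('s, 'c, 'r) contract set \<Rightarrow> bool" where
  "matching M \<mu> \<longleftrightarrow>
     \<mu> \<subseteq> contracts M \<and> (\<forall>s\<in>students M. \<forall>p p'. (s, p) \<in> \<mu> \<longrightarrow> (s, p') \<in> \<mu> \<longrightarrow> p = p')"

text \<open>
  The contract of a student occurs in two roles: as the outcome the student compares
  with others, and as the part to be deleted from the matching. The latter is a set with at
  most one element, empty if the student is unmatched.
\<close>

definition outcome_of :: "('s, 'c, 'r) contract set \<Rightarrow> 's \<Rightarrow> ('c, 'r) outcome" where
  "outcome_of \<mu> s = (if \<exists>p. (s, p) \<in> \<mu> then Some (THE p. (s, p) \<in> \<mu>) else None)"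

definition contract_of :: "('s, 'c, 'r) contract set \<Rightarrow> 's \<Rightarrow> ('s, 'c, 'r) contract set" where
  "contract_of \<mu> s = {x \<in> \<mu>. fst x = s}"

definition feasible :: "('s, 'c, 'r) market \<Rightarrow> ('s, 'c, 'r) contract set \<Rightarrow> bool" where
  "feasible M \<mu> \<longleftrightarrow> matching M \<mu> \<and>
     (\<forall>c\<in>colleges M. card {(s, c', r) \<in> \<mu>. c' = c} \<le> quota M c) \<and>
     (\<forall>r\<in>resources M.
        card {(s, c, r') \<in> \<mu>. r' = Some r} \<le> cap M (Some r) \<and>
        (\<forall>s c. (s, c, Some r) \<in> \<mu> \<longrightarrow> c \<in> region M (Some r)))"

definition individually_rational ::
    "('s, 'c, 'r) market \<Rightarrow> ('s, 'c, 'r) contract set \<Rightarrow> bool" where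
  "individually_rational M \<mu> \<longleftrightarrow> (\<forall>(s, c, r) \<in> \<mu>. acceptable M s (c, r))"

text \<open>
  The blocking notions are meant for matchings that are feasible and individually rational.
\<close>

definition envy_blocks_through ::
    "('s, 'c, 'r) market \<Rightarrow> ('s, 'c, 'r) contract set \<Rightarrow> ('s, 'c, 'r) contract \<Rightarrow>
     ('s, 'c, 'r) contract \<Rightarrow> bool" where
  "envy_blocks_through M \<mu> = (\<lambda>(s, c, r) (s', c', r').
     c' = c \<and> (s, c, r) \<in> contracts M - \<mu> \<and> (s', c, r') \<in> \<mu> \<and>
     (Some (c, r), outcome_of \<mu> s) \<in> student_pref M s \<and>
     (s, s') \<in> college_pref M c \<and>
     feasible M ((\<mu> - (contract_of \<mu> s \<union> {(s', c, r')})) \<union> {(s, c, r)}))"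

definition direct_envy_blocks ::
    "('s, 'c, 'r) market \<Rightarrow> ('s, 'c, 'r) contract set \<Rightarrow> ('s, 'c, 'r) contract \<Rightarrow> bool" where
  "direct_envy_blocks M \<mu> = (\<lambda>(s, c, r).
     \<exists>s' r'. envy_blocks_through M \<mu> (s, c, r) (s', c, r') \<and> r \<in> {r', None})"

definition waste_blocks ::
    "('s, 'c, 'r) market \<Rightarrow> ('s, 'c, 'r) contract set \<Rightarrow> ('s, 'c, 'r) contract \<Rightarrow> bool" where
  "waste_blocks M \<mu> = (\<lambda>(s, c, r).
     (s, c, r) \<in> contracts M - \<mu> \<and>
     (Some (c, r), outcome_of \<mu> s) \<in> student_pref M s \<and>
     feasible M ((\<mu> - contract_of \<mu> s) \<union> {(s, c, r)}))"

definition resource_blocks ::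
    "('s, 'c, 'r) market \<Rightarrow> ('s, 'c, 'r) contract set \<Rightarrow> ('s, 'c, 'r) contract \<Rightarrow> bool" where
  "resource_blocks M \<mu> = (\<lambda>(s, c, r).
     waste_blocks M \<mu> (s, c, r) \<and> (\<exists>r'. r' \<noteq> r \<and> (s, c, r') \<in> \<mu>))"

definition resource_efficient ::
    "('s, 'c, 'r) market \<Rightarrow> ('s, 'c, 'r) contract set \<Rightarrow> bool" where
  "resource_efficient M \<mu> \<longleftrightarrow> \<not> (\<exists>x. resource_blocks M \<mu> x)"

definition dominated ::
    "('s, 'c, 'r) market \<Rightarrow> ('s, 'c, 'r) contract set \<Rightarrow> ('s, 'c, 'r) contract \<Rightarrow> bool" where
  "dominated M \<mu> = (\<lambda>(s, c, r).
     \<exists>s' r'. (s', c, r') \<in> contracts M - \<mu> \<and>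
       \<not> waste_blocks M \<mu> (s', c, r') \<and> \<not> direct_envy_blocks M \<mu> (s', c, r') \<and>
       direct_envy_blocks M ((\<mu> - contract_of \<mu> s) \<union> {(s, c, r)}) (s', c, r'))"

definition direct_envy_stable ::
    "('s, 'c, 'r) market \<Rightarrow> ('s, 'c, 'r) contract set \<Rightarrow> bool" where
  "direct_envy_stable M \<mu> \<longleftrightarrow>
     feasible M \<mu> \<and> individually_rational M \<mu> \<and>
     \<not> (\<exists>x. direct_envy_blocks M \<mu> x) \<and>
     (\<forall>x. waste_blocks M \<mu> x \<longrightarrow> dominated M \<mu> x)"

end

theory Submission
  imports Defs
begin

text \<open>
  The witness has students 0, 1, 2, colleges \<open>A\<close> (encoded as 0, two seats) and \<open>B\<close> (encoded
  as 1, one seat), and two units of a single resource \<open>r\<close> usable at both colleges.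
  College \<open>A\<close> ranks 1, 2, 0 and \<open>B\<close> ranks 0, 2, 1. Student 0 wants \<open>(A, r), (B, r)\<close>,
  student 1 wants \<open>(B, r), (B, r\<^sub>0), (A, r)\<close>, and student 2 wants only \<open>(B, r)\<close>.
  The resulting cycle: if student 1 holds \<open>(B, r\<^sub>0)\<close>, then student 0 takes \<open>(A, r)\<close> and
  resource efficiency forces the upgrade to \<open>(B, r)\<close>; now student 2 envies 1 at \<open>B\<close>, and
  if 2 takes the seat, student 1 falls back on \<open>(A, r)\<close> at the expense of 0. Then 0 envies 2
  at \<open>B\<close>; with 0 at \<open>B\<close> the two seats of \<open>A\<close> let 0 move back to \<open>(A, r)\<close>, which
  leaves the seat at \<open>B\<close> to student 1 without the resource.
\<close>

section \<open>Matchings as graphs of assignments\<close>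

text \<open>A matching is handled as the graph of an assignment of outcomes to students, so that each
  deviation in the blocking notions becomes a function update.\<close>

definition graph :: "('s, 'c, 'r) market \<Rightarrow> ('s \<Rightarrow> ('c, 'r) outcome) \<Rightarrow> ('s, 'c, 'r) contract set" where
  "graph M a = {(s, p). s \<in> students M \<and> a s = Some p}"

lemma mem_graph [simp]: "(s, p) \<in> graph M a \<longleftrightarrow> s \<in> students M \<and> a s = Some p"
  by (simp add: graph_def)

lemma outcome_of_graph [simp]: "s \<in> students M \<Longrightarrow> outcome_of (graph M a) s = a s"
  by (cases "a s") (auto simp: outcome_of_def)

text \<open>Uniqueness of each student's contract makes the \<open>THE\<close> in
  \<open>outcome_of\<close> return it. Hence no matching is lost by passing to assignments.\<close>

lemma graph_outcome_of:
  assumes "matching M \<mu>"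
  shows "graph M (outcome_of \<mu>) = \<mu>"
proof -
  have 1: "s \<in> students M" if "(s, p) \<in> \<mu>" for s p
    using assms that by (auto simp: matching_def contracts_def)
  have 2: "(THE p. (s, p) \<in> \<mu>) = p" if "(s, p) \<in> \<mu>" for s p
    using assms that 1 by (intro the_equality) (unfold matching_def, blast+)
  show ?thesis
    using 1 2 by (fastforce simp: graph_def outcome_of_def split: if_splits)
qed

lemma graph_reassign:
  assumes "s \<in> students M"
  shows "(graph M a - contract_of (graph M a) s) \<union> {(s, p)} = graph M (a(s := Some p))"
  using assms by (auto simp: contract_of_def split: if_splits)

text \<open>Clearing \<open>t\<close> before setting \<open>s\<close> gives the right update even
  for \<open>s = t\<close>.\<close>

lemma graph_replace:
  assumes "s \<in> students M" "a t = Some q"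
  shows "(graph M a - (contract_of (graph M a) s \<union> {(t, q)})) \<union> {(s, p)}
    = graph M (a(t := None, s := Some p))"
  using assms by (auto simp: contract_of_def split: if_splits)

text \<open>A graph has at most one contract per student, so projecting to the student is injective.
  The resulting sum of indicators evaluates once the student set is explicit.\<close>

lemma card_graph:
  assumes "finite (students M)"
  shows "card {(s, c, r). (s, c, r) \<in> graph M a \<and> Q c r}
    = (\<Sum>s\<in>students M. of_bool (\<exists>c r. a s = Some (c, r) \<and> Q c r))"
proof -
  have "bij_betw fst {(s, c, r). (s, c, r) \<in> graph M a \<and> Q c r}
      {s \<in> students M. \<exists>c r. a s = Some (c, r) \<and> Q c r}"
    by (force simp: bij_betw_def inj_on_def)
  then have "card {(s, c, r). (s, c, r) \<in> graph M a \<and> Q c r}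
      = card {s \<in> students M. \<exists>c r. a s = Some (c, r) \<and> Q c r}"
    by (rule bij_betw_same_card)
  also have "\<dots> = (\<Sum>s\<in>students M. of_bool (\<exists>c r. a s = Some (c, r) \<and> Q c r))"
    using assms by (simp add: Int_def)
  finally show ?thesis .
qed

lemma matching_graph: "matching M (graph M a) \<longleftrightarrow> (\<forall>s\<in>students M. a s \<in> outcomes M)"
proof -
  have "graph M a \<subseteq> contracts M \<longleftrightarrow> (\<forall>s\<in>students M. a s \<in> outcomes M)"
  proof safe
    fix s
    assume "graph M a \<subseteq> contracts M" "s \<in> students M"
    then show "a s \<in> outcomes M"
      by (cases "a s") (auto simp: outcomes_def contracts_def subset_iff)
  next
    fix s c r
    assume "\<forall>s\<in>students M. a s \<in> outcomes M" "(s, c, r) \<in> graph M a"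
    then show "(s, c, r) \<in> contracts M"
      by (force simp: outcomes_def contracts_def)
  qed
  then show ?thesis
    by (auto simp: matching_def)
qed

lemma feasible_graph:
  assumes "finite (students M)"
  shows "feasible M (graph M a) \<longleftrightarrow>
     (\<forall>s\<in>students M. a s \<in> outcomes M) \<and>
     (\<forall>c\<in>colleges M. (\<Sum>s\<in>students M. of_bool (\<exists>r. a s = Some (c, r))) \<le> quota M c) \<and>
     (\<forall>r\<in>resources M.
        (\<Sum>s\<in>students M. of_bool (\<exists>c. a s = Some (c, Some r))) \<le> cap M (Some r) \<and>
        (\<forall>s\<in>students M. \<forall>c. a s = Some (c, Some r) \<longrightarrow> c \<in> region M (Some r)))"
  unfolding feasible_def matching_graph
  using card_graph[OF assms, of a "\<lambda>c' r. c' = c" for c]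
    card_graph[OF assms, of a "\<lambda>c r'. r' = Some r" for r]
  by (auto simp del: sum_of_bool_eq)

section \<open>Blocking and domination for assignments\<close>

lemma direct_envy_blocks_graph:
  assumes "matching_market M" "s \<in> students M" "t \<in> students M"
    and "c \<in> colleges M" "r \<in> resources0 M"
    and "(Some (c, r), a s) \<in> student_pref M s"
    and "a t = Some (c, r')" "(s, t) \<in> college_pref M c" "r \<in> {r', None}"
    and "feasible M (graph M (a(t := None, s := Some (c, r))))"
  shows "direct_envy_blocks M (graph M a) (s, c, r)"
proof -
  \<comment> \<open>Irreflexivity shows that a contract preferred to the current one lies outside
    the matching, as blocking requires.\<close>
  have "(Some (c, r), Some (c, r)) \<notin> student_pref M s"
    using assms(1,2)
    by (auto simp: matching_market_def strict_ranking_def strict_linear_order_on_def irrefl_def)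
  then have "a s \<noteq> Some (c, r)"
    using assms(6) by auto
  then have "envy_blocks_through M (graph M a) (s, c, r) (t, c, r')"
    using assms unfolding envy_blocks_through_def prod.case
    by (subst graph_replace) (auto simp: contracts_def)
  then show ?thesis
    using assms(9) by (auto simp: direct_envy_blocks_def)
qed

lemma waste_blocks_graph:
  assumes "matching_market M" "s \<in> students M" "c \<in> colleges M" "r \<in> resources0 M"
    and "(Some (c, r), a s) \<in> student_pref M s"
    and "feasible M (graph M (a(s := Some (c, r))))"
  shows "waste_blocks M (graph M a) (s, c, r)"
proof -
  have "(Some (c, r), Some (c, r)) \<notin> student_pref M s"
    using assms(1,2)
    by (auto simp: matching_market_def strict_ranking_def strict_linear_order_on_def irrefl_def)
  then have "a s \<noteq> Some (c, r)"
    using assms(5) by auto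
  then show ?thesis
    using assms unfolding waste_blocks_def prod.case
    by (subst graph_reassign) (auto simp: contracts_def)
qed

text \<open>This weak consequence of domination drops feasibility and the conditions on the old matching;
  it already fails for every waste-blocking contract used below.\<close>

lemma dominated_graphD:
  assumes "dominated M (graph M a) (s, c, r)" "s \<in> students M"
  defines "b \<equiv> a(s := Some (c, r))"
  shows "\<exists>s'\<in>students M. \<exists>t\<in>students M. \<exists>r' r''. (Some (c, r'), b s') \<in> student_pref M s' \<and>
    b t = Some (c, r'') \<and> (s', t) \<in> college_pref M c \<and> r' \<in> {r'', None}"
proof -
  obtain s' r' where "s' \<in> students M" "direct_envy_blocks M (graph M b) (s', c, r')"
    using assms(1) unfolding dominated_def prod.case graph_reassign[OF assms(2)] b_def
    by (auto simp: contracts_def)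
  then show ?thesis
    by (fastforce simp: direct_envy_blocks_def envy_blocks_through_def)
qed

section \<open>The example market\<close>

fun list_ranking :: "'a list \<Rightarrow> 'a rel" where
  "list_ranking [] = {}"
| "list_ranking (x # xs) = {x} \<times> set xs \<union> list_ranking xs"

lemma strict_ranking_list_ranking:
  "distinct xs \<Longrightarrow> strict_ranking (set xs) (list_ranking xs)"
proof (induction xs)
  case (Cons x xs)
  then have "list_ranking xs \<subseteq> set xs \<times> set xs" "strict_linear_order_on (set xs) (list_ranking xs)"
    by (auto simp: strict_ranking_def)
  with Cons.prems show ?case
    unfolding strict_ranking_def strict_linear_order_on_def trans_def irrefl_def total_on_def
    by simp blast
qed (simp add: strict_ranking_def strict_linear_order_on_def)

text \<open>Lists run from best to worst; entries after \<open>None\<close> are unacceptable and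
  complete the ranking. Each acceptable \<open>Some (c, Some 0)\<close> precedes
  \<open>Some (c, None)\<close>, as \<open>matching_market\<close> demands, and \<open>cap\<close>
  is 3 at \<open>None\<close> because there are three students.\<close>

definition example_market :: "(nat, nat, nat) market" where
  "example_market = \<lparr>
     students = {0, 1, 2}, colleges = {0, 1}, resources = {0},
     quota = (\<lambda>c. if c = 0 then 2 else 1),
     region = (\<lambda>r. {0, 1}),
     cap = (\<lambda>r. if r = None then 3 else 2),
     college_pref = (\<lambda>c. list_ranking (if c = 0 then [1, 2, 0] else [0, 2, 1])),
     student_pref = (\<lambda>s. list_ranking
       (if s = 0 then [Some (0, Some 0), Some (1, Some 0), None, Some (0, None), Some (1, None)]
        else if s = 1 then
          [Some (1, Some 0), Some (1, None), Some (0, Some 0), None, Some (0, None)]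
        else [Some (1, Some 0), None, Some (0, Some 0), Some (0, None), Some (1, None)]))\<rparr>"

lemma example_market_simps [simp]:
  "students example_market = {0, 1, 2}"
  "colleges example_market = {0, 1}"
  "resources example_market = {0}"
  "resources0 example_market = {None, Some 0}"
  "outcomes example_market
    = {None, Some (0, None), Some (0, Some 0), Some (1, None), Some (1, Some 0)}"
  by (auto simp: example_market_def resources0_def outcomes_def)

lemma example_prefs:
  "college_pref example_market c = list_ranking (if c = 0 then [1, 2, 0] else [0, 2, 1])"
  "student_pref example_market s = list_ranking
     (if s = 0 then [Some (0, Some 0), Some (1, Some 0), None, Some (0, None), Some (1, None)]
      else if s = 1 then [Some (1, Some 0), Some (1, None), Some (0, Some 0), None, Some (0, None)]
      else [Some (1, Some 0), None, Some (0, Some 0), Some (0, None), Some (1, None)])"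
  by (simp_all add: example_market_def)

lemma matching_market_example: "matching_market example_market"
proof -
  have 1: "strict_ranking (students example_market) (college_pref example_market c)" for c
  proof -
    define xs :: "nat list" where "xs = (if c = 0 then [1, 2, 0] else [0, 2, 1])"
    have "college_pref example_market c = list_ranking xs"
      by (simp add: example_market_def xs_def)
    moreover have "set xs = students example_market" "distinct xs"
      by (auto simp: xs_def)
    ultimately show ?thesis
      using strict_ranking_list_ranking by metis
  qed
  have 2: "strict_ranking (outcomes example_market) (student_pref example_market s)" for s
  proof -
    define xs :: "(nat, nat) outcome list" where "xs =
      (if s = 0 then [Some (0, Some 0), Some (1, Some 0), None, Some (0, None), Some (1, None)]
       else if s = 1 then
         [Some (1, Some 0), Some (1, None), Some (0, Some 0), None, Some (0, None)]
       else [Some (1, Some 0), None, Some (0, Some 0), Some (0, None), Some (1, None)])"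
    have "student_pref example_market s = list_ranking xs"
      by (simp add: example_market_def xs_def)
    moreover have "set xs = outcomes example_market" "distinct xs"
      by (auto simp: xs_def)
    ultimately show ?thesis
      using strict_ranking_list_ranking by metis
  qed
  show ?thesis
    unfolding matching_market_def
    using 1 2 by (auto simp: acceptable_def) (auto simp: example_market_def)
qed

lemma feasible_example:
  "feasible example_market (graph example_market a) \<longleftrightarrow>
     a 0 \<in> outcomes example_market \<and> a 1 \<in> outcomes example_market \<and>
     a 2 \<in> outcomes example_market \<and>
     (\<Sum>s\<in>{0, 1, 2}. of_bool (\<exists>r. a s = Some (0, r))) \<le> (2::nat) \<and>
     (\<Sum>s\<in>{0, 1, 2}. of_bool (\<exists>r. a s = Some (1, r))) \<le> (1::nat) \<and>
     (\<Sum>s\<in>{0, 1, 2}. of_bool (\<exists>c. a s = Some (c, Some 0))) \<le> (2::nat)"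
proof -
  have "finite (students example_market)"
    "quota example_market 0 = 2" "quota example_market 1 = 1" "cap example_market (Some 0) = 2"
    "region example_market (Some 0) = {0, 1}"
    by (simp_all add: example_market_def)
  note params = this
  \<comment> \<open>The region of the resource contains both colleges, so the region condition
    follows from \<open>a s\<close> being an outcome.\<close>
  have "c \<in> {0, 1}" if "a s = Some (c, Some 0)" "a s \<in> outcomes example_market" for s c
    using that by auto
  then have region: "(\<forall>s\<in>{0, 1, 2}. a s \<in> outcomes example_market) \<Longrightarrow>
      (\<forall>s\<in>{0, 1, 2}. \<forall>c. a s = Some (c, Some 0) \<longrightarrow> c \<in> {0, 1})"
    by blast
  show ?thesis
    unfolding feasible_graph[OF params(1)] example_market_simps(1-3)
    unfolding ball_simps(5,7) params
    using region unfolding ball_simps(5,7) by argo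
qed

section \<open>Elimination of all candidate matchings\<close>

lemma not_stable_efficient_example:
  assumes stable: "direct_envy_stable example_market (graph example_market a)"
    and efficient: "resource_efficient example_market (graph example_market a)"
  shows False
proof -
  let ?M = example_market
  have feasible: "feasible ?M (graph ?M a)" and rational: "individually_rational ?M (graph ?M a)"
    using stable by (auto simp: direct_envy_stable_def)
  \<comment> \<open>Individual rationality leaves each student only \<open>None\<close> and the
    outcomes listed before it.\<close>
  have "a s = None \<or> (a s, None) \<in> student_pref ?M s" if "s \<in> {0, 1, 2}" for s
    using rational that by (cases "a s") (force simp: individually_rational_def acceptable_def)+
  from this[of 0] this[of 1] this[of 2]
  have outcomes: "a 0 \<in> {None, Some (0, Some 0), Some (1, Some 0)}"
    "a 1 \<in> {None, Some (0, Some 0), Some (1, None), Some (1, Some 0)}"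
    "a 2 \<in> {None, Some (1, Some 0)}"
    by (auto simp: example_market_def)
  have counts: "(\<Sum>s\<in>{0, 1, 2}. of_bool (\<exists>r. a s = Some (1, r))) \<le> (1::nat)"
    "(\<Sum>s\<in>{0, 1, 2}. of_bool (\<exists>c. a s = Some (c, Some 0))) \<le> (2::nat)"
    using feasible unfolding feasible_example by blast+
  \<comment> \<open>Every envy used below is between two contracts that carry the resource.\<close>
  have no_envy: False
    if "s \<in> {0, 1, 2}" "t \<in> {0, 1, 2}" "c \<in> {0, 1}"
      and "(Some (c, Some 0), a s) \<in> student_pref ?M s"
      and "a t = Some (c, Some 0)" "(s, t) \<in> college_pref ?M c"
      and "feasible ?M (graph ?M (a(t := None, s := Some (c, Some 0))))" for s t c
    using direct_envy_blocks_graph[OF matching_market_example, of s t c "Some 0" a "Some 0"]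
      that stable by (auto simp: direct_envy_stable_def)
  have no_waste: False
    if "s \<in> {0, 1, 2}" "c \<in> {0, 1}" "r \<in> {None, Some 0}"
      and "(Some (c, r), a s) \<in> student_pref ?M s"
      and "feasible ?M (graph ?M (a(s := Some (c, r))))"
      and "\<not> (\<exists>s'\<in>{0, 1, 2}. \<exists>t\<in>{0, 1, 2}. \<exists>r' r''.
        (Some (c, r'), (a(s := Some (c, r))) s') \<in> student_pref ?M s' \<and>
        (a(s := Some (c, r))) t = Some (c, r'') \<and> (s', t) \<in> college_pref ?M c \<and>
        r' \<in> {r'', None})" for s c r
  proof -
    have "dominated ?M (graph ?M a) (s, c, r)"
      using waste_blocks_graph[OF matching_market_example, of s c r a] that(1-5) stable
      by (auto simp: direct_envy_stable_def)
    then show False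
      using dominated_graphD[of ?M a s c r] that(1,6) by simp
  qed
  have no_resource: False if "a 1 = Some (1, None)"
    and "feasible ?M (graph ?M (a(1 := Some (1, Some 0))))"
  proof -
    have "waste_blocks ?M (graph ?M a) (1, 1, Some 0)"
      using that by (intro waste_blocks_graph[OF matching_market_example])
        (auto simp: example_market_def resources0_def)
    then have "resource_blocks ?M (graph ?M a) (1, 1, Some 0)"
      using that by (force simp: resource_blocks_def)
    then show False
      using efficient by (auto simp: resource_efficient_def)
  qed
  \<comment> \<open>Otherwise \<open>sum_of_bool_eq\<close> would turn the indicator sums back into
    cardinalities before they unfold over the three students.\<close>
  note [simp] = feasible_example example_prefs and [simp del] = sum_of_bool_eq
  \<comment> \<open>Of the 3 * 4 * 2 acceptable combinations, the single seat at college 1 and the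
    two resource units leave these 13.\<close>
  consider
      "a 2 = Some (1, Some 0)" "a 0 = None" "a 1 = None"
    | "a 2 = Some (1, Some 0)" "a 0 = None" "a 1 = Some (0, Some 0)"
    | "a 2 = Some (1, Some 0)" "a 0 = Some (0, Some 0)" "a 1 = None"
    | "a 2 = None" "a 0 = Some (1, Some 0)" "a 1 = None"
    | "a 2 = None" "a 0 = Some (1, Some 0)" "a 1 = Some (0, Some 0)"
    | "a 2 = None" "a 0 = None" "a 1 = Some (1, Some 0)"
    | "a 2 = None" "a 0 = Some (0, Some 0)" "a 1 = Some (1, Some 0)"
    | "a 2 = None" "a 0 = None" "a 1 = Some (1, None)"
    | "a 2 = None" "a 0 = Some (0, Some 0)" "a 1 = Some (1, None)"
    | "a 2 = None" "a 0 = None" "a 1 = None"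
    | "a 2 = None" "a 0 = None" "a 1 = Some (0, Some 0)"
    | "a 2 = None" "a 0 = Some (0, Some 0)" "a 1 = None"
    | "a 2 = None" "a 0 = Some (0, Some 0)" "a 1 = Some (0, Some 0)"
    using outcomes counts
    by (elim insertE emptyE) simp_all
  then show False
  proof cases
    case 1
    then show False
      by (intro no_waste[of 1 0 "Some 0"]) auto
  next
    case 2
    then show False
      by (intro no_envy[of 0 2 1]) auto
  next
    case 3
    then show False
      by (intro no_envy[of 1 0 0]) auto
  next
    case 4
    then show False
      by (intro no_waste[of 1 0 "Some 0"]) auto
  next
    \<comment> \<open>Both students ahead of 0 at college 0 raise no claim after the move: 1 already
      holds \<open>(0, Some 0)\<close>, and 2 accepts nothing there.\<close>
    case 5
    then show False
      by (intro no_waste[of 0 0 "Some 0"]) auto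
  next
    case 6
    then show False
      by (intro no_waste[of 0 0 "Some 0"]) auto
  next
    case 7
    then show False
      by (intro no_envy[of 2 1 1]) auto
  next
    case 8
    then show False
      by (intro no_waste[of 0 0 "Some 0"]) auto
  next
    \<comment> \<open>Only this case uses \<open>efficient\<close>: the upgrade of student 1 is
      dominated, since student 2 would then envy 1 at college 1.\<close>
    case 9
    then show False
      by (intro no_resource) auto
  next
    case 10
    then show False
      by (intro no_waste[of 0 1 "Some 0"]) auto
  next
    case 11
    then show False
      by (intro no_waste[of 0 1 "Some 0"]) auto
  next
    case 12
    then show False
      by (intro no_envy[of 1 0 0]) auto
  next
    \<comment> \<open>Student 1 must ask for the seat without the resource: with it, the move would
      be dominated by \<open>(2, 1, Some 0)\<close>. Without it, direct envy could only claim
      \<open>(1, None)\<close>, which neither 0 nor 2 accepts.\<close>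
    case 13
    then show False
      by (intro no_waste[of 1 1 None]) auto
  qed
qed

theorem proposition2:
  shows "\<exists>M :: (nat, nat, nat) market. matching_market M \<and>
    \<not> (\<exists>\<mu>. direct_envy_stable M \<mu> \<and> resource_efficient M \<mu>)"
proof (intro exI conjI notI)
  show "matching_market example_market"
    by (rule matching_market_example)
  assume "\<exists>\<mu>. direct_envy_stable example_market \<mu> \<and> resource_efficient example_market \<mu>"
  then obtain \<mu> where \<mu>: "direct_envy_stable example_market \<mu>" "resource_efficient example_market \<mu>"
    by blast
  then have "graph example_market (outcome_of \<mu>) = \<mu>"
    by (intro graph_outcome_of) (simp add: direct_envy_stable_def feasible_def)
  with \<mu> show False
    using not_stable_efficient_example[of "outcome_of \<mu>"] by simp
qed

end
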